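(* Suppose that an Arrow-Debreu equilibrium (as defined in the context) exists and that the utility functions $\tilde u_{i,s}$ are differentiable. Let $p^\star$ be the contingent power injection plan obtained in the limit of the trading process, i.e. an optimal solution of the social welfare maximization problem described in the context. Let $x^\star$ be the corresponding network injection plan, $x^\star_{n,s}=\sum_{i\in\mathcal I_n}p^\star_{i,s}$, and let $\lambda^\star$ be the corresponding optimal locational marginal prices, i.e. the optimal dual variables of the nodal balance constraints. These prices satisfy $$\lambda^\star_{n,s}=-\mathbb P(s)\frac{\partial\tilde u_{i,s}(p^\star_{i,s})}{\partial p_{i,s}}+(\overline\eta^\star_{i,s}-\underline\eta^\star_{i,s})$$ for real-time participants $i\in\mathcal I_n^{\mathrm{RT}}$, where $\overline\eta^\star_{i,s},\underline\eta^\star_{i,s}$ are the optimal dual variables of the upper and lower bounds on $p_{i,s}$; the last term vanishes when $p^\star_{i,s}$ is interior to $\mathcal P_{i,s}$. Then $(p^\star,x^\star,\lambda^\star)$ constitutes an Arrow-Debreu equilibrium.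
   Context: **Network.** There are $N$ buses and $L$ lines. With $\widehat H\in\mathbb R^{L\times N}$ and capacities $\bar r\in\mathbb R^L$, the set of feasible nodal injections is $\mathcal P=\{p\in\mathbb R^N:-\bar r\le\widehat Hp\le\bar r,\ \mathbf 1^\top p=0\}$, assumed to have nonempty interior relative to $\{p:\mathbf 1^\top p=0\}$. **Uncertainty.** There are finitely many scenarios $s\in[S]=\{1,\dots,S\}$ with probabilities $\mathbb P(s)>0$ summing to $1$. **Participants.** $\mathcal I=\bigcup_{n\in[N]}\mathcal I_n$ is a finite set, $\mathcal I_n$ (pairwise disjoint) being the participants at bus $n$. Each $\mathcal I_n$ is partitioned into day-ahead participants $\mathcal I_n^{\mathrm{DA}}$ and real-time participants $\mathcal I_n^{\mathrm{RT}}$; $\mathcal I^{\mathrm{DA}}=\bigcup_n\mathcal I_n^{\mathrm{DA}}$ and $\mathcal I^{\mathrm{RT}}=\bigcup_n\mathcal I_n^{\mathrm{RT}}$. Participant $i$ has plan $p_i=(p_{i,s})_s\in\mathbb R^S$. For each $s$, $\mathcal P_{i,s}=[\underline p_{i,s},\overline p_{i,s}]$ is a compact interval of the form $[0,\bar p_{i,s}]$ (producer) or $[-\bar p_{i,s},0]$ (load). Let $\bar{\mathcal P}_i=\{p_i:p_{i,s}\in\mathcal P_{i,s}\ \forall s\}$; $\mathcal P_i=\bar{\mathcal P}_i$ for $i\in\mathcal I^{\mathrm{RT}}$, and $\mathcal P_i=\bar{\mathcal P}_i\cap\{p_i:p_{i,s}=p_{i,\tilde s}\ \forall s,\tilde s\}$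 for $i\in\mathcal I^{\mathrm{DA}}$. The utility from injection in scenario $s$ is a concave function $\tilde u_{i,s}:\mathbb R\to\mathbb R$. **Social welfare maximization problem** (under budget balance). Maximize $U(p)=\sum_{i\in\mathcal I}\sum_{s\in[S]}\mathbb P(s)\tilde u_{i,s}(p_{i,s})$ over $(p,x)$ subject to $p_i\in\mathcal P_i$ ($i\in\mathcal I$), $x_{n,s}=\sum_{i\in\mathcal I_n}p_{i,s}$ ($n\in[N],s\in[S]$), and $x_s=(x_{n,s})_n\in\mathcal P$ ($s\in[S]$). **Dual variables.** The Lagrangian is $$U(p)+\sum_{n,s}\lambda_{n,s}\Big(\sum_{i\in\mathcal I_n}p_{i,s}-x_{n,s}\Big)-\sum_{i\in\mathcal I^{\mathrm{RT}},s}\overline\eta_{i,s}(p_{i,s}-\overline p_{i,s})-\sum_{i\in\mathcal I^{\mathrm{RT}},s}\underline\eta_{i,s}(\underline p_{i,s}-p_{i,s}).$$ Optimal dual variables are multipliers with $\underline\eta^\star,\overline\eta^\star\ge0$ such that $(p^\star,x^\star)$ maximizes the Lagrangian over $p_i\in\mathbb R^S$ ($i\in\mathcal I^{\mathrm{RT}}$), $p_i\in\mathcal P_i$ ($i\in\mathcal I^{\mathrm{DA}}$), $x_s\in\mathcal P$ ($s\in[S]$), and complementary slackness holds: $\overline\eta^\star_{i,s}(p^\star_{i,s}-\overline p_{i,s})=0$ and $\underline\eta^\star_{i,s}(\underline p_{i,s}-p^\star_{i,s})=0$. **Arrow-Debreu equilibrium.** A triple $(p^\star,x^\star,\lambda^\star)$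 with $p^\star\in\mathbb R^{|\mathcal I|\times S}$, $x^\star\in\mathbb R^{N\times S}$, $\lambda^\star\in\mathbb R^{N\times S}$ is an Arrow-Debreu equilibrium if: (i) for every $n$ and $i\in\mathcal I_n$, $p_i^\star$ maximizes $\sum_{s\in[S]}\big(\lambda^\star_{n,s}p_{i,s}+\mathbb P(s)\tilde u_{i,s}(p_{i,s})\big)$ over $p_i\in\mathcal P_i$; (ii) $x^\star$ maximizes $\sum_{s\in[S]}\sum_{n\in[N]}-\lambda^\star_{n,s}x_{n,s}$ subject to $x_s\in\mathcal P$ for all $s\in[S]$; (iii) $x^\star_{n,s}=\sum_{i\in\mathcal I_n}p^\star_{i,s}$ for all $n\in[N]$, $s\in[S]$. *)

theory Defs
  imports "HOL-Analysis.Analysis"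
begin

text \<open>
  Buses, lines and scenarios are the elements of the finite types \<open>'n\<close>, \<open>'l\<close>, \<open>'s\<close>.
  An array indexed by bus and scenario has type \<open>real^'s^'n\<close>, with entry \<open>x $ n $ s\<close>, so that the
  network injection in scenario \<open>s\<close> is \<open>column s x\<close>.  Plans are functions \<open>'i \<Rightarrow> real^'s\<close> whose
  values outside the finite set of participants are irrelevant.
\<close>

record ('n, 'l, 's, 'i) market =
  shift_factors :: "real^'n^'l"
  capacity :: "real^'l"
  scenario_prob :: "'s \<Rightarrow> real"
  day_ahead :: "'n \<Rightarrow> 'i set"
  real_time :: "'n \<Rightarrow> 'i set"
  lower :: "'i \<Rightarrow> 's \<Rightarrow> real"
  upper :: "'i \<Rightarrow> 's \<Rightarrow> real"
  utility :: "'i \<Rightarrow> 's \<Rightarrow> real \<Rightarrow> real"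

definition participants_at :: "('n::finite, 'l::finite, 's::finite, 'i) market \<Rightarrow> 'n \<Rightarrow> 'i set" where
  "participants_at M n = day_ahead M n \<union> real_time M n"

definition participants :: "('n::finite, 'l::finite, 's::finite, 'i) market \<Rightarrow> 'i set" where
  "participants M = (\<Union>n. participants_at M n)"

definition all_day_ahead :: "('n::finite, 'l::finite, 's::finite, 'i) market \<Rightarrow> 'i set" where
  "all_day_ahead M = (\<Union>n. day_ahead M n)"

definition all_real_time :: "('n::finite, 'l::finite, 's::finite, 'i) market \<Rightarrow> 'i set" where
  "all_real_time M = (\<Union>n. real_time M n)"

definition injections :: "('n::finite, 'l::finite, 's::finite, 'i) market \<Rightarrow> (real^'n) set" where
  "injections M = {q. (\<forall>l. - capacity M $ l \<le> (shift_factors M *v q) $ l \<and>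
                            (shift_factors M *v q) $ l \<le> capacity M $ l) \<and>
                      (\<Sum>n\<in>UNIV. q $ n) = 0}"

definition box_plans :: "('n::finite, 'l::finite, 's::finite, 'i) market \<Rightarrow> 'i \<Rightarrow> (real^'s) set" where
  "box_plans M i = {q. \<forall>s. q $ s \<in> {lower M i s..upper M i s}}"

definition plans :: "('n::finite, 'l::finite, 's::finite, 'i) market \<Rightarrow> 'i \<Rightarrow> (real^'s) set" where
  "plans M i = (if i \<in> all_day_ahead M then box_plans M i \<inter> {q. \<forall>s t. q $ s = q $ t}
                else box_plans M i)"

locale electricity_market =
  fixes M :: "('n::finite, 'l::finite, 's::finite, 'i) market"
  assumes injections_interior:
      "(top_of_set {q. (\<Sum>n\<in>UNIV. q $ n) = 0}) interior_of (injections M) \<noteq> {}"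
    and prob_pos: "\<And>s. scenario_prob M s > 0"
    and prob_sum: "(\<Sum>s\<in>UNIV. scenario_prob M s) = 1"
    and finite_participants: "finite (participants M)"
    and disjoint_buses: "\<And>m n. m \<noteq> n \<Longrightarrow> participants_at M m \<inter> participants_at M n = {}"
    and disjoint_stages: "\<And>n. day_ahead M n \<inter> real_time M n = {}"
    and producer_or_load: "\<And>i s. i \<in> participants M \<Longrightarrow>
      \<exists>b\<ge>0. (lower M i s = 0 \<and> upper M i s = b) \<or> (lower M i s = - b \<and> upper M i s = 0)"
    and concave_utility: "\<And>i s. i \<in> participants M \<Longrightarrow> concave_on UNIV (utility M i s)"

definition welfare ::
    "('n::finite, 'l::finite, 's::finite, 'i) market \<Rightarrow> ('i \<Rightarrow> real^'s) \<Rightarrow> real" where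
  "welfare M p =
    (\<Sum>i\<in>participants M. \<Sum>s\<in>UNIV. scenario_prob M s * utility M i s (p i $ s))"

definition welfare_feasible ::
    "('n::finite, 'l::finite, 's::finite, 'i) market \<Rightarrow> ('i \<Rightarrow> real^'s) \<Rightarrow> real^'s^'n \<Rightarrow> bool" where
  "welfare_feasible M p x \<longleftrightarrow>
    (\<forall>i\<in>participants M. p i \<in> plans M i) \<and>
    (\<forall>n s. x $ n $ s = (\<Sum>i\<in>participants_at M n. p i $ s)) \<and>
    (\<forall>s. column s x \<in> injections M)"

definition welfare_optimal ::
    "('n::finite, 'l::finite, 's::finite, 'i) market \<Rightarrow> ('i \<Rightarrow> real^'s) \<Rightarrow> real^'s^'n \<Rightarrow> bool" where
  "welfare_optimal M p x \<longleftrightarrow>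
    is_arg_max (\<lambda>(p, x). welfare M p) (\<lambda>(p, x). welfare_feasible M p x) (p, x)"

definition lagrangian ::
    "('n::finite, 'l::finite, 's::finite, 'i) market \<Rightarrow> real^'s^'n \<Rightarrow> ('i \<Rightarrow> 's \<Rightarrow> real) \<Rightarrow>
     ('i \<Rightarrow> 's \<Rightarrow> real) \<Rightarrow> ('i \<Rightarrow> real^'s) \<Rightarrow> real^'s^'n \<Rightarrow> real" where
  "lagrangian M lmp \<eta>up \<eta>lo p x =
    welfare M p
    + (\<Sum>n\<in>UNIV. \<Sum>s\<in>UNIV. lmp $ n $ s * ((\<Sum>i\<in>participants_at M n. p i $ s) - x $ n $ s))
    - (\<Sum>i\<in>all_real_time M. \<Sum>s\<in>UNIV. \<eta>up i s * (p i $ s - upper M i s))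
    - (\<Sum>i\<in>all_real_time M. \<Sum>s\<in>UNIV. \<eta>lo i s * (lower M i s - p i $ s))"

definition optimal_duals ::
    "('n::finite, 'l::finite, 's::finite, 'i) market \<Rightarrow> ('i \<Rightarrow> real^'s) \<Rightarrow> real^'s^'n \<Rightarrow>
     real^'s^'n \<Rightarrow> ('i \<Rightarrow> 's \<Rightarrow> real) \<Rightarrow> ('i \<Rightarrow> 's \<Rightarrow> real) \<Rightarrow> bool" where
  "optimal_duals M p x lmp \<eta>up \<eta>lo \<longleftrightarrow>
    (\<forall>i\<in>all_real_time M. \<forall>s. \<eta>up i s \<ge> 0 \<and> \<eta>lo i s \<ge> 0) \<and>
    is_arg_max (\<lambda>(p, x). lagrangian M lmp \<eta>up \<eta>lo p x)
      (\<lambda>(p, x). (\<forall>i\<in>all_day_ahead M. p i \<in> plans M i) \<and> (\<forall>s. column s x \<in> injections M))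
      (p, x) \<and>
    (\<forall>i\<in>all_real_time M. \<forall>s. \<eta>up i s * (p i $ s - upper M i s) = 0 \<and>
                               \<eta>lo i s * (lower M i s - p i $ s) = 0)"

definition arrow_debreu_equilibrium ::
    "('n::finite, 'l::finite, 's::finite, 'i) market \<Rightarrow> ('i \<Rightarrow> real^'s) \<Rightarrow> real^'s^'n \<Rightarrow>
     real^'s^'n \<Rightarrow> bool" where
  "arrow_debreu_equilibrium M p x lmp \<longleftrightarrow>
    (\<forall>n. \<forall>i\<in>participants_at M n.
      is_arg_max (\<lambda>q. \<Sum>s\<in>UNIV. lmp $ n $ s * q $ s + scenario_prob M s * utility M i s (q $ s))
        (\<lambda>q. q \<in> plans M i) (p i)) \<and>
    is_arg_max (\<lambda>y. \<Sum>s\<in>UNIV. \<Sum>n\<in>UNIV. - lmp $ n $ s * y $ n $ s)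
      (\<lambda>y. \<forall>s. column s y \<in> injections M) x \<and>
    (\<forall>n s. x $ n $ s = (\<Sum>i\<in>participants_at M n. p i $ s))"

end

theory Submission
  imports Defs
begin

text \<open>
  For fixed prices the Lagrangian splits into one term per participant and one term for the network.
  If \<open>(p', x', lmp')\<close> is an equilibrium, then \<open>(p', x')\<close> maximises every term of the Lagrangian at
  \<open>lmp'\<close>; the nodal balances make the Lagrangian equal to the welfare at \<open>(p', x')\<close> and at any
  welfare optimum \<open>(p, x)\<close>, so \<open>(p, x)\<close> maximises every term as well and the same prices \<open>lmp'\<close>
  support it.  For a real-time participant, the positive and negative parts of the
  derivative of its objective at the optimum then serve as the multipliers of its bounds.  Conversely,
  a maximiser of the Lagrangian maximises each term separately; stationarity of a real-time term
  is the price formula, and complementary slackness gives optimality over the box.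
\<close>

section \<open>Separable sums and concave maximisation on the real line\<close>

text \<open>Reduces optimality of a whole plan to optimality in one scenario: when only the entry at
  \<open>s\<close> is replaced, all other summands cancel.\<close>

lemma sum_replace_component:
  fixes q :: "real^'s" and h :: "'s \<Rightarrow> real \<Rightarrow> real"
  shows "(\<Sum>t\<in>UNIV. h t ((\<chi> t. if t = s then y else q $ t) $ t))
    = (\<Sum>t\<in>UNIV. h t (q $ t)) - h s (q $ s) + h s y"
proof -
  have "(\<Sum>t\<in>UNIV - {s}. h t ((\<chi> t. if t = s then y else q $ t) $ t)) = (\<Sum>t\<in>UNIV - {s}. h t (q $ t))"
    by (rule sum.cong) auto
  then show ?thesis
    by (simp add: sum.remove[of UNIV s])
qed

text \<open>A nonzero derivative allows a strict improvement by a small step in its direction; only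
  an endpoint can block that step. This is the source of complementary slackness.\<close>

lemma interval_max_deriv:
  fixes f :: "real \<Rightarrow> real"
  assumes deriv: "(f has_real_derivative g) (at c)"
    and c: "c \<in> {a..b}"
    and max: "\<And>y. y \<in> {a..b} \<Longrightarrow> f y \<le> f c"
  shows interval_max_deriv_pos: "g > 0 \<Longrightarrow> c = b"
    and interval_max_deriv_neg: "g < 0 \<Longrightarrow> c = a"
proof -
  show "c = b" if "g > 0"
  proof (rule ccontr)
    assume "c \<noteq> b"
    then have "c < b" using c by simp
    obtain d where d: "d > 0" "\<And>h. h > 0 \<Longrightarrow> h < d \<Longrightarrow> f c < f (c + h)"
      using DERIV_pos_inc_right[OF deriv \<open>g > 0\<close>] by blast
    \<comment> \<open>Halving keeps \<open>h\<close> strictly below \<open>d\<close>; the cap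
      \<open>b - c\<close> keeps \<open>c + h\<close> in the interval.\<close>
    define h where "h = min (d / 2) (b - c)"
    have "f c < f (c + h)"
      using d \<open>c < b\<close> by (intro d(2)) (auto simp: h_def)
    moreover have "c + h \<in> {a..b}"
      using c d \<open>c < b\<close> by (auto simp: h_def)
    ultimately show False using max[of "c + h"] by linarith
  qed
  show "c = a" if "g < 0"
  proof (rule ccontr)
    assume "c \<noteq> a"
    then have "a < c" using c by simp
    obtain d where d: "d > 0" "\<And>h. h > 0 \<Longrightarrow> h < d \<Longrightarrow> f c < f (c - h)"
      using DERIV_neg_dec_left[OF deriv \<open>g < 0\<close>] by blast
    define h where "h = min (d / 2) (c - a)"
    have "f c < f (c - h)"
      using d \<open>a < c\<close> by (intro d(2)) (auto simp: h_def)
    moreover have "c - h \<in> {a..b}"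
      using c d \<open>a < c\<close> by (auto simp: h_def)
    ultimately show False using max[of "c - h"] by linarith
  qed
qed

text \<open>The tangent inequality for the convex function \<open>- f\<close>; it turns a
  first-order condition into global maximality.\<close>

lemma concave_on_le_tangent:
  fixes f :: "real \<Rightarrow> real"
  assumes "concave_on UNIV f" and "(f has_real_derivative g) (at c)"
  shows "f y \<le> f c + g * (y - c)"
proof -
  have "(- f y) - (- f c) \<ge> (- g) * (y - c)"
  proof (rule convex_on_imp_above_tangent)
    show "convex_on UNIV (\<lambda>x. - f x)"
      using assms(1) by (simp add: concave_on_def)
    show "((\<lambda>x. - f x) has_field_derivative - g) (at c within UNIV)"
      by (intro derivative_intros) (use assms(2) in simp)
  qed auto
  then show ?thesis by (simp add: algebra_simps)
qed

text \<open>A single strict term would order the sums strictly. This passes from equal totals to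
  equal values for each participant.\<close>

lemma sum_mono_eq_terms:
  fixes f g :: "'a \<Rightarrow> real"
  assumes "finite A" and "\<And>a. a \<in> A \<Longrightarrow> f a \<le> g a" and "sum g A \<le> sum f A" and "a \<in> A"
  shows "f a = g a"
proof (rule ccontr)
  assume "f a \<noteq> g a"
  then have "f a < g a" using assms(2,4) by fastforce
  then have "sum f A < sum g A"
    using assms by (intro sum_strict_mono_ex1) auto
  then show False using assms(3) by simp
qed

section \<open>The separate objectives inside the Lagrangian\<close>

text \<open>Pairs keep the bus beside the participant, so that one sum over participants can refer
  to nodal prices.\<close>

definition agents :: "('n::finite, 'l::finite, 's::finite, 'i) market \<Rightarrow> ('n \<times> 'i) set" where
  "agents M = Sigma UNIV (participants_at M)"

definition agent_value ::
    "('n::finite, 'l::finite, 's::finite, 'i) market \<Rightarrow> real^'s^'n \<Rightarrow> 'n \<Rightarrow> 'i \<Rightarrow> real^'s \<Rightarrow> real" where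
  "agent_value M lmp n i q =
    (\<Sum>s\<in>UNIV. lmp $ n $ s * q $ s + scenario_prob M s * utility M i s (q $ s))"

definition network_value :: "real^'s::finite^'n::finite \<Rightarrow> real^'s^'n \<Rightarrow> real" where
  "network_value lmp y = (\<Sum>s\<in>UNIV. \<Sum>n\<in>UNIV. - lmp $ n $ s * y $ n $ s)"

text \<open>Extended by zero outside \<open>all_real_time M\<close>, so that the bound terms fit
  into a single sum over all participants.\<close>

definition bound_penalty ::
    "('n::finite, 'l::finite, 's::finite, 'i) market \<Rightarrow> ('i \<Rightarrow> 's \<Rightarrow> real) \<Rightarrow> ('i \<Rightarrow> 's \<Rightarrow> real) \<Rightarrow>
     'i \<Rightarrow> real^'s \<Rightarrow> real" where
  "bound_penalty M \<eta>up \<eta>lo i q = (if i \<in> all_real_time M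
     then \<Sum>s\<in>UNIV. \<eta>up i s * (q $ s - upper M i s) + \<eta>lo i s * (lower M i s - q $ s) else 0)"

lemma equilibrium_iff:
  "arrow_debreu_equilibrium M p x lmp \<longleftrightarrow>
    (\<forall>(n, i)\<in>agents M. p i \<in> plans M i \<and>
       (\<forall>q\<in>plans M i. agent_value M lmp n i q \<le> agent_value M lmp n i (p i))) \<and>
    (\<forall>s. column s x \<in> injections M) \<and>
    (\<forall>y. (\<forall>s. column s y \<in> injections M) \<longrightarrow> network_value lmp y \<le> network_value lmp x) \<and>
    (\<forall>n s. x $ n $ s = (\<Sum>i\<in>participants_at M n. p i $ s))"
  unfolding arrow_debreu_equilibrium_def is_arg_max_linorder agents_def agent_value_def
    network_value_def
  by fastforce

section \<open>Bus and stage of a participant\<close>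

context electricity_market
begin

lemma finite_participants_at [simp]: "finite (participants_at M n)"
  using finite_participants by (rule finite_subset[rotated]) (auto simp: participants_def)

lemma finite_agents [simp]: "finite (agents M)"
  by (simp add: agents_def)

lemma agents_bus_unique: "(n, i) \<in> agents M \<Longrightarrow> (m, i) \<in> agents M \<Longrightarrow> m = n"
  using disjoint_buses[of m n] by (auto simp: agents_def)

lemma agents_participant: "(n, i) \<in> agents M \<Longrightarrow> i \<in> participants M"
  by (auto simp: agents_def participants_def)

text \<open>\<open>disjoint_stages\<close> compares the two stages at one bus only; uniqueness of
  the bus excludes being day-ahead at one bus and real-time at another.\<close>

lemma agents_stage:
  assumes "(n, i) \<in> agents M"
  shows "i \<in> all_day_ahead M \<longleftrightarrow> i \<notin> all_real_time M"
proof -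
  have "m = n" if "i \<in> day_ahead M m \<or> i \<in> real_time M m" for m
    using that assms by (intro agents_bus_unique[of n i]) (auto simp: agents_def participants_at_def)
  moreover have "i \<in> day_ahead M n \<or> i \<in> real_time M n"
    using assms by (auto simp: agents_def participants_at_def)
  ultimately show ?thesis
    using disjoint_stages[of n] unfolding all_day_ahead_def all_real_time_def by blast
qed

lemma sum_participants_eq: "(\<Sum>i\<in>participants M. h i) = (\<Sum>(n, i)\<in>agents M. h i)"
  using disjoint_buses
  by (simp add: participants_def agents_def sum.UNION_disjoint sum.Sigma)

section \<open>Decomposition of the Lagrangian\<close>

text \<open>Swapping sums credits each participant with the price at its own bus, and
  \<open>network_value\<close> collects the terms in \<open>x\<close>. Under nodal balance the left
  side is just the welfare.\<close>

lemma welfare_plus_balance: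
  "welfare M p
    + (\<Sum>n\<in>UNIV. \<Sum>s\<in>UNIV. lmp $ n $ s * ((\<Sum>i\<in>participants_at M n. p i $ s) - x $ n $ s))
   = (\<Sum>(n, i)\<in>agents M. agent_value M lmp n i (p i)) + network_value lmp x"
proof -
  have "(\<Sum>n\<in>UNIV. \<Sum>s\<in>UNIV. lmp $ n $ s * (\<Sum>i\<in>participants_at M n. p i $ s))
      = (\<Sum>n\<in>UNIV. \<Sum>i\<in>participants_at M n. \<Sum>s\<in>UNIV. lmp $ n $ s * p i $ s)"
    unfolding sum_distrib_left by (subst sum.swap) simp
  also have "\<dots> = (\<Sum>(n, i)\<in>agents M. \<Sum>s\<in>UNIV. lmp $ n $ s * p i $ s)"
    unfolding agents_def by (rule sum.Sigma) simp_all
  finally have balance: "(\<Sum>n\<in>UNIV. \<Sum>s\<in>UNIV. lmp $ n $ s * (\<Sum>i\<in>participants_at M n. p i $ s))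
      = (\<Sum>(n, i)\<in>agents M. \<Sum>s\<in>UNIV. lmp $ n $ s * p i $ s)" .
  have "network_value lmp x = - (\<Sum>n\<in>UNIV. \<Sum>s\<in>UNIV. lmp $ n $ s * x $ n $ s)"
    unfolding network_value_def by (subst sum.swap) (simp add: sum_negf)
  then show ?thesis
    unfolding welfare_def sum_participants_eq agent_value_def
    by (simp add: right_diff_distrib sum_subtractf balance sum.distrib case_prod_unfold)
qed

lemma lagrangian_decomposition:
  "lagrangian M lmp \<eta>up \<eta>lo p x =
    (\<Sum>(n, i)\<in>agents M. agent_value M lmp n i (p i) - bound_penalty M \<eta>up \<eta>lo i (p i))
    + network_value lmp x"
proof -
  have sub: "all_real_time M \<subseteq> participants M"
    by (auto simp: all_real_time_def participants_def participants_at_def)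
  have "(\<Sum>i\<in>all_real_time M. \<Sum>s\<in>UNIV. \<eta>up i s * (p i $ s - upper M i s))
      + (\<Sum>i\<in>all_real_time M. \<Sum>s\<in>UNIV. \<eta>lo i s * (lower M i s - p i $ s))
      = (\<Sum>i\<in>all_real_time M. bound_penalty M \<eta>up \<eta>lo i (p i))"
    by (simp add: bound_penalty_def sum.distrib)
  also have "\<dots> = (\<Sum>i\<in>participants M. bound_penalty M \<eta>up \<eta>lo i (p i))"
    by (rule sum.mono_neutral_left) (use sub finite_participants in \<open>auto simp: bound_penalty_def\<close>)
  finally show ?thesis
    unfolding lagrangian_def welfare_plus_balance sum_participants_eq
    by (simp add: sum_subtractf case_prod_unfold)
qed

text \<open>The bus of \<open>i\<close> is unique, so the new plan enters exactly one summand. This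
  tests the Lagrangian against a deviation by one participant.\<close>

lemma sum_agents_fun_upd:
  fixes F :: "'n \<Rightarrow> 'i \<Rightarrow> real^'s \<Rightarrow> real"
  assumes "(n, i) \<in> agents M"
  shows "(\<Sum>(m, j)\<in>agents M. F m j ((p(i := q)) j))
    = (\<Sum>(m, j)\<in>agents M. F m j (p j)) - F n i (p i) + F n i q"
proof -
  have "(\<Sum>(m, j)\<in>agents M - {(n, i)}. F m j ((p(i := q)) j))
      = (\<Sum>(m, j)\<in>agents M - {(n, i)}. F m j (p j))"
  proof (rule sum.cong)
    fix a assume "a \<in> agents M - {(n, i)}"
    then have "snd a \<noteq> i"
      using agents_bus_unique[OF assms, of "fst a"] by (cases a) auto
    then show "(case a of (m, j) \<Rightarrow> F m j ((p(i := q)) j)) = (case a of (m, j) \<Rightarrow> F m j (p j))"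
      by (simp add: case_prod_unfold)
  qed simp
  then show ?thesis
    by (simp add: sum.remove[OF finite_agents assms])
qed

section \<open>Equilibrium prices at a welfare optimum\<close>

lemma equilibrium_welfare_feasible:
  "arrow_debreu_equilibrium M p x lmp \<Longrightarrow> welfare_feasible M p x"
  unfolding equilibrium_iff welfare_feasible_def
  by (auto simp: agents_def participants_def)

lemma equilibrium_prices_support_optimum:
  assumes eq: "arrow_debreu_equilibrium M p' x' lmp" and opt: "welfare_optimal M p x"
  shows "arrow_debreu_equilibrium M p x lmp"
proof -
  have feas: "welfare_feasible M p x"
    and best: "welfare M p' \<le> welfare M p"
    using opt equilibrium_welfare_feasible[OF eq]
    unfolding welfare_optimal_def is_arg_max_linorder by auto
  have plan: "p i \<in> plans M i" if "(n, i) \<in> agents M" for n i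
    using feas agents_participant[OF that] by (simp add: welfare_feasible_def)
  have bal: "x $ n $ s = (\<Sum>i\<in>participants_at M n. p i $ s)" for n s
    using feas by (simp add: welfare_feasible_def)
  have bal': "x' $ n $ s = (\<Sum>i\<in>participants_at M n. p' i $ s)" for n s
    using eq by (simp add: equilibrium_iff)
  have agent_le: "agent_value M lmp n i q \<le> agent_value M lmp n i (p' i)"
    if "(n, i) \<in> agents M" "q \<in> plans M i" for n i q
    using eq that by (auto simp: equilibrium_iff)
  have net_le: "network_value lmp x \<le> network_value lmp x'"
    using eq feas by (auto simp: equilibrium_iff welfare_feasible_def)
  let ?v = "\<lambda>p (n, i). agent_value M lmp n i (p i)"
  \<comment> \<open>Both plans satisfy the nodal balance, so this is \<open>best\<close> rewritten
    by \<open>welfare_plus_balance\<close>.\<close>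
  have "sum (?v p') (agents M) + network_value lmp x' \<le> sum (?v p) (agents M) + network_value lmp x"
    using best welfare_plus_balance[of p lmp x] welfare_plus_balance[of p' lmp x'] bal bal' by simp
  moreover have "sum (?v p) (agents M) \<le> sum (?v p') (agents M)"
    by (rule sum_mono) (auto intro: agent_le plan)
  \<comment> \<open>The total at \<open>(p, x)\<close> is no smaller than at
    \<open>(p', x')\<close>, while neither of its two parts can be larger; hence both parts
    agree.\<close>
  ultimately have net: "network_value lmp x = network_value lmp x'"
    and sums: "sum (?v p') (agents M) \<le> sum (?v p) (agents M)"
    using net_le by linarith+
  have "agent_value M lmp n i (p i) = agent_value M lmp n i (p' i)" if "(n, i) \<in> agents M" for n i
    using sum_mono_eq_terms[OF finite_agents _ sums that] agent_le plan by auto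
  then show ?thesis
    using eq feas plan agent_le net unfolding equilibrium_iff welfare_feasible_def by auto
qed

section \<open>Construction of the bound multipliers\<close>

lemma real_time_plans:
  "(n, i) \<in> agents M \<Longrightarrow> i \<in> all_real_time M \<Longrightarrow> plans M i = box_plans M i"
  using agents_stage by (simp add: plans_def)

lemma equilibrium_imp_optimal_duals:
  assumes eq: "arrow_debreu_equilibrium M p x lmp"
    and diff: "\<And>i s y. i \<in> participants M \<Longrightarrow> utility M i s differentiable (at y)"
  shows "\<exists>\<eta>up \<eta>lo. optimal_duals M p x lmp \<eta>up \<eta>lo"
proof -
  \<comment> \<open>The marginal payoff of \<open>i\<close> at its plan. Multipliers carry no bus
    index, so the bus is recovered as the unique one hosting \<open>i\<close>.\<close>
  define g where "g i s = lmp $ (THE n. (n, i) \<in> agents M) $ s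
    + scenario_prob M s * deriv (utility M i s) (p i $ s)" for i s
  have g: "g i s = lmp $ n $ s + scenario_prob M s * deriv (utility M i s) (p i $ s)"
    if "(n, i) \<in> agents M" for n i s
  proof -
    have "(THE n. (n, i) \<in> agents M) = n"
      using that by (rule the_equality) (rule agents_bus_unique[OF that])
    then show ?thesis by (simp add: g_def)
  qed
  \<comment> \<open>A marginal payoff pushing upwards is charged to the upper bound, one pushing
    downwards to the lower bound.\<close>
  define \<eta>up where "\<eta>up i s = max (g i s) 0" for i s
  define \<eta>lo where "\<eta>lo i s = max (- g i s) 0" for i s
  have \<eta>: "\<eta>up i s - \<eta>lo i s = g i s" for i s
    by (auto simp: \<eta>up_def \<eta>lo_def)
  define f where "f n i s y = lmp $ n $ s * y + scenario_prob M s * utility M i s y" for n i s y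
  have f_deriv: "(f n i s has_real_derivative g i s) (at (p i $ s))"
    if "(n, i) \<in> agents M" for n i s
  proof -
    have "(utility M i s has_real_derivative deriv (utility M i s) (p i $ s)) (at (p i $ s))"
      using diff[OF agents_participant[OF that]] DERIV_deriv_iff_real_differentiable by blast
    then show ?thesis
      unfolding f_def g[OF that] by (auto intro!: derivative_eq_intros)
  qed
  have f_concave: "concave_on UNIV (f n i s)" if "(n, i) \<in> agents M" for n i s
  proof -
    have "concave_on UNIV (\<lambda>y. scenario_prob M s * utility M i s y)"
      using concave_utility[OF agents_participant[OF that]] prob_pos[of s]
      by (intro concave_on_cmul) auto
    then show ?thesis
      unfolding f_def
      by (intro concave_on_add) (simp_all add: concave_on_iff algebra_simps)
  qed
  have slack: "\<eta>up i s * (p i $ s - upper M i s) = 0 \<and> \<eta>lo i s * (lower M i s - p i $ s) = 0"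
    if a: "(n, i) \<in> agents M" and rt: "i \<in> all_real_time M" for n i s
  proof -
    have box: "p i \<in> box_plans M i"
      using eq a real_time_plans[OF a rt] by (auto simp: equilibrium_iff)
    have max: "f n i s y \<le> f n i s (p i $ s)" if "y \<in> {lower M i s..upper M i s}" for y
    proof -
      \<comment> \<open>A real-time plan may change in one scenario alone, since its feasible set is
        a product of intervals.\<close>
      let ?q = "\<chi> t. if t = s then y else p i $ t"
      have "?q \<in> box_plans M i"
        using box that by (auto simp: box_plans_def)
      then have "agent_value M lmp n i ?q \<le> agent_value M lmp n i (p i)"
        using eq a real_time_plans[OF a rt] by (auto simp: equilibrium_iff)
      then show ?thesis
        using sum_replace_component[of "f n i" s y "p i"]
        unfolding agent_value_def f_def by linarith
    qed
    have mem: "p i $ s \<in> {lower M i s..upper M i s}"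
      using box by (simp add: box_plans_def)
    have "g i s > 0 \<Longrightarrow> p i $ s = upper M i s" "g i s < 0 \<Longrightarrow> p i $ s = lower M i s"
      using interval_max_deriv[OF f_deriv[OF a] mem max] by blast+
    then show ?thesis
      by (cases "g i s" "0 :: real" rule: linorder_cases) (simp_all add: \<eta>up_def \<eta>lo_def)
  qed
  have agent_le: "agent_value M lmp n i (q i) - bound_penalty M \<eta>up \<eta>lo i (q i)
      \<le> agent_value M lmp n i (p i) - bound_penalty M \<eta>up \<eta>lo i (p i)"
    if a: "(n, i) \<in> agents M" and q: "\<forall>i\<in>all_day_ahead M. q i \<in> plans M i" for n i q
  proof (cases "i \<in> all_real_time M")
    case True
    \<comment> \<open>The penalty subtracts slope \<open>g i s\<close>, which flattens the tangent
      at \<open>p i $ s\<close>; by concavity this point is then maximal on the whole line, beyond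
      the bounds as well.\<close>
    have "f n i s (q i $ s)
          - (\<eta>up i s * (q i $ s - upper M i s) + \<eta>lo i s * (lower M i s - q i $ s))
        \<le> f n i s (p i $ s)
          - (\<eta>up i s * (p i $ s - upper M i s) + \<eta>lo i s * (lower M i s - p i $ s))" for s
      using concave_on_le_tangent[OF f_concave[OF a] f_deriv[OF a], of s "q i $ s"]
      by (simp add: algebra_simps flip: \<eta>)
    then have "(\<Sum>s\<in>UNIV. f n i s (q i $ s)
          - (\<eta>up i s * (q i $ s - upper M i s) + \<eta>lo i s * (lower M i s - q i $ s)))
        \<le> (\<Sum>s\<in>UNIV. f n i s (p i $ s)
          - (\<eta>up i s * (p i $ s - upper M i s) + \<eta>lo i s * (lower M i s - p i $ s)))"
      by (rule sum_mono)
    then show ?thesis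
      using True by (simp add: agent_value_def bound_penalty_def f_def sum_subtractf)
  next
    case False
    \<comment> \<open>Day-ahead participants carry no penalty and keep the constraint
      \<open>plans M i\<close> in the Lagrangian, so equilibrium optimality is exactly what is
      asked.\<close>
    then show ?thesis
      using eq a q agents_stage[OF a] by (auto simp: equilibrium_iff bound_penalty_def)
  qed
  have lagrangian_le: "lagrangian M lmp \<eta>up \<eta>lo q y \<le> lagrangian M lmp \<eta>up \<eta>lo p x"
    if "\<forall>i\<in>all_day_ahead M. q i \<in> plans M i" "\<forall>s. column s y \<in> injections M" for q y
    unfolding lagrangian_decomposition
    using eq agent_le that by (intro add_mono sum_mono) (auto simp: equilibrium_iff)
  have agent_ex: "\<exists>n. (n, i) \<in> agents M" if "i \<in> all_day_ahead M \<union> all_real_time M" for i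
    using that by (auto simp: agents_def all_day_ahead_def all_real_time_def participants_at_def)
  have plan: "p i \<in> plans M i" if "i \<in> all_day_ahead M" for i
    using eq agent_ex[of i] that by (auto simp: equilibrium_iff)
  have "column s x \<in> injections M" for s
    using eq by (simp add: equilibrium_iff)
  moreover have "\<eta>up i s * (p i $ s - upper M i s) = 0 \<and> \<eta>lo i s * (lower M i s - p i $ s) = 0"
    if "i \<in> all_real_time M" for i s
    using agent_ex[of i] slack that by blast
  moreover have "0 \<le> \<eta>up i s" "0 \<le> \<eta>lo i s" for i s
    by (simp_all add: \<eta>up_def \<eta>lo_def)
  ultimately have "optimal_duals M p x lmp \<eta>up \<eta>lo"
    using lagrangian_le plan unfolding optimal_duals_def is_arg_max_linorder
    by (simp del: mult_eq_0_iff)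
  then show ?thesis by blast
qed

section \<open>Consequences of dual optimality\<close>

text \<open>Deviate in the plan of \<open>i\<close> only. A real-time \<open>q\<close> is
  unrestricted because its bounds have been moved into the Lagrangian.\<close>

lemma optimal_duals_agent_max:
  assumes dual: "optimal_duals M p x lmp \<eta>up \<eta>lo"
    and a: "(n, i) \<in> agents M" and q: "i \<in> all_day_ahead M \<Longrightarrow> q \<in> plans M i"
  shows "agent_value M lmp n i q - bound_penalty M \<eta>up \<eta>lo i q
    \<le> agent_value M lmp n i (p i) - bound_penalty M \<eta>up \<eta>lo i (p i)"
proof -
  have "lagrangian M lmp \<eta>up \<eta>lo (p(i := q)) x \<le> lagrangian M lmp \<eta>up \<eta>lo p x"
    using dual q unfolding optimal_duals_def is_arg_max_linorder by auto
  then show ?thesis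
    unfolding lagrangian_decomposition
    using sum_agents_fun_upd[OF a,
        of "\<lambda>n i q. agent_value M lmp n i q - bound_penalty M \<eta>up \<eta>lo i q" p q]
    by linarith
qed

lemma optimal_duals_network_max:
  assumes dual: "optimal_duals M p x lmp \<eta>up \<eta>lo" and y: "\<forall>s. column s y \<in> injections M"
  shows "network_value lmp y \<le> network_value lmp x"
proof -
  have "lagrangian M lmp \<eta>up \<eta>lo p y \<le> lagrangian M lmp \<eta>up \<eta>lo p x"
    using dual y unfolding optimal_duals_def is_arg_max_linorder by auto
  then show ?thesis
    unfolding lagrangian_decomposition by simp
qed

text \<open>Complementary slackness removes every term at the optimum; inside the box, nonnegative
  multipliers meet nonpositive constraint values.\<close>

lemma optimal_duals_penalty:
  assumes dual: "optimal_duals M p x lmp \<eta>up \<eta>lo"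
  shows optimal_duals_penalty_zero: "bound_penalty M \<eta>up \<eta>lo i (p i) = 0"
    and optimal_duals_penalty_nonpos: "q \<in> box_plans M i \<Longrightarrow> bound_penalty M \<eta>up \<eta>lo i q \<le> 0"
proof -
  have slack: "\<eta>up i s * (p i $ s - upper M i s) = 0" "\<eta>lo i s * (lower M i s - p i $ s) = 0"
    if "i \<in> all_real_time M" for s
    using dual that unfolding optimal_duals_def by blast+
  show "bound_penalty M \<eta>up \<eta>lo i (p i) = 0"
    by (simp add: bound_penalty_def slack)
  show "bound_penalty M \<eta>up \<eta>lo i q \<le> 0" if "q \<in> box_plans M i"
    using dual that
    by (auto simp: optimal_duals_def bound_penalty_def box_plans_def
        intro!: sum_nonpos add_nonpos_nonpos mult_nonneg_nonpos)
qed

lemma optimal_duals_imp_equilibrium: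
  assumes feas: "welfare_feasible M p x" and dual: "optimal_duals M p x lmp \<eta>up \<eta>lo"
  shows "arrow_debreu_equilibrium M p x lmp"
proof -
  have "agent_value M lmp n i q \<le> agent_value M lmp n i (p i)"
    if a: "(n, i) \<in> agents M" and q: "q \<in> plans M i" for n i q
  proof -
    have "q \<in> box_plans M i"
      using q by (auto simp: plans_def split: if_splits)
    \<comment> \<open>Dropping the penalty is safe on both sides: subtracting it can only raise the
      value at \<open>q\<close>, and it is zero at \<open>p i\<close>.\<close>
    then show ?thesis
      using optimal_duals_agent_max[OF dual a, of q] q optimal_duals_penalty_zero[OF dual, of i]
        optimal_duals_penalty_nonpos[OF dual, of q i]
      by simp
  qed
  then show ?thesis
    using feas optimal_duals_network_max[OF dual] agents_participant
    unfolding equilibrium_iff welfare_feasible_def by auto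
qed

text \<open>In the Lagrangian each entry of a real-time plan ranges over the whole line, so the
  derivative of its summand vanishes at the optimum.\<close>

lemma optimal_duals_price_formula:
  assumes dual: "optimal_duals M p x lmp \<eta>up \<eta>lo"
    and a: "(n, i) \<in> agents M" and rt: "i \<in> all_real_time M"
    and diff: "utility M i s differentiable (at (p i $ s))"
  shows "lmp $ n $ s
    = - scenario_prob M s * deriv (utility M i s) (p i $ s) + (\<eta>up i s - \<eta>lo i s)"
proof -
  define h where "h s y = lmp $ n $ s * y + scenario_prob M s * utility M i s y
    - (\<eta>up i s * (y - upper M i s) + \<eta>lo i s * (lower M i s - y))" for s y
  have val: "agent_value M lmp n i q - bound_penalty M \<eta>up \<eta>lo i q = (\<Sum>s\<in>UNIV. h s (q $ s))" for q
    using rt by (simp add: agent_value_def bound_penalty_def h_def sum_subtractf)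
  have max: "h s y \<le> h s (p i $ s)" for y
  proof -
    let ?q = "\<chi> t. if t = s then y else p i $ t"
    have "(\<Sum>s\<in>UNIV. h s (?q $ s)) \<le> (\<Sum>s\<in>UNIV. h s (p i $ s))"
      using optimal_duals_agent_max[OF dual a, of ?q] rt agents_stage[OF a] by (simp only: val) blast
    then show ?thesis
      using sum_replace_component[of h s y "p i"] by linarith
  qed
  have "(utility M i s has_real_derivative deriv (utility M i s) (p i $ s)) (at (p i $ s))"
    using diff DERIV_deriv_iff_real_differentiable by blast
  then have "(h s has_real_derivative lmp $ n $ s
      + scenario_prob M s * deriv (utility M i s) (p i $ s) - (\<eta>up i s - \<eta>lo i s)) (at (p i $ s))"
    unfolding h_def by (auto intro!: derivative_eq_intros)
  \<comment> \<open>The maximum is global, so the radius 1 for the local test is arbitrary.\<close>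
  then have "lmp $ n $ s
      + scenario_prob M s * deriv (utility M i s) (p i $ s) - (\<eta>up i s - \<eta>lo i s) = 0"
    by (rule DERIV_local_max[OF _ zero_less_one]) (simp add: max)
  then show ?thesis by simp
qed

text \<open>Away from both endpoints each slackness product has a nonzero factor, so both
  multipliers are zero.\<close>

lemma optimal_duals_interior:
  assumes dual: "optimal_duals M p x lmp \<eta>up \<eta>lo" and rt: "i \<in> all_real_time M"
    and int: "p i $ s \<in> interior {lower M i s..upper M i s}"
  shows "\<eta>up i s - \<eta>lo i s = 0"
proof -
  have "p i $ s \<noteq> upper M i s" "p i $ s \<noteq> lower M i s"
    using int by (auto simp: interior_atLeastAtMost_real)
  moreover have "\<eta>up i s * (p i $ s - upper M i s) = 0" "\<eta>lo i s * (lower M i s - p i $ s) = 0"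
    using dual rt by (auto simp: optimal_duals_def)
  ultimately show ?thesis by auto
qed

end

theorem lemma2:
  fixes M :: "('n::finite, 'l::finite, 's::finite, 'i) market"
    and p :: "'i \<Rightarrow> real^'s" and x :: "real^'s^'n"
  assumes "electricity_market M"
    and "\<exists>p' x' lmp'. arrow_debreu_equilibrium M p' x' lmp'"
    and "\<And>i s y. i \<in> participants M \<Longrightarrow> utility M i s differentiable (at y)"
    and "welfare_optimal M p x"
  shows "(\<exists>lmp \<eta>up \<eta>lo. optimal_duals M p x lmp \<eta>up \<eta>lo) \<and>
    (\<forall>lmp \<eta>up \<eta>lo. optimal_duals M p x lmp \<eta>up \<eta>lo \<longrightarrow>
      (\<forall>n. \<forall>i\<in>real_time M n. \<forall>s.
        lmp $ n $ s = - scenario_prob M s * deriv (utility M i s) (p i $ s) + (\<eta>up i s - \<eta>lo i s) \<and>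
        (p i $ s \<in> interior {lower M i s..upper M i s} \<longrightarrow> \<eta>up i s - \<eta>lo i s = 0)) \<and>
      arrow_debreu_equilibrium M p x lmp)"
proof -
  interpret electricity_market M by fact
  obtain p' x' lmp' where "arrow_debreu_equilibrium M p' x' lmp'"
    using assms(2) by blast
  \<comment> \<open>The given equilibrium may have other plans; only its prices are carried over to
    the optimum.\<close>
  then have "arrow_debreu_equilibrium M p x lmp'"
    using assms(4) by (rule equilibrium_prices_support_optimum)
  then have "\<exists>lmp \<eta>up \<eta>lo. optimal_duals M p x lmp \<eta>up \<eta>lo"
    using equilibrium_imp_optimal_duals assms(3) by blast
  \<comment> \<open>This covers arbitrary optimal duals, not just those built from
    \<open>lmp'\<close>.\<close>
  moreover have "arrow_debreu_equilibrium M p x lmp"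
    if "optimal_duals M p x lmp \<eta>up \<eta>lo" for lmp \<eta>up \<eta>lo
  proof (rule optimal_duals_imp_equilibrium[OF _ that])
    show "welfare_feasible M p x"
      using assms(4) by (auto simp: welfare_optimal_def is_arg_max_linorder)
  qed
  moreover have "lmp $ n $ s
        = - scenario_prob M s * deriv (utility M i s) (p i $ s) + (\<eta>up i s - \<eta>lo i s) \<and>
      (p i $ s \<in> interior {lower M i s..upper M i s} \<longrightarrow> \<eta>up i s - \<eta>lo i s = 0)"
    if dual: "optimal_duals M p x lmp \<eta>up \<eta>lo" and i: "i \<in> real_time M n" for lmp \<eta>up \<eta>lo n i s
  proof -
    have "(n, i) \<in> agents M" "i \<in> all_real_time M"
      using i by (auto simp: agents_def participants_at_def all_real_time_def)
    then show ?thesis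
      using optimal_duals_price_formula[OF dual] optimal_duals_interior[OF dual]
        assms(3) agents_participant by blast
  qed
  ultimately show ?thesis by blast
qed

end
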